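(* Assume that $a=1$ and $\gamma=0$. Then, for $n\ge1$ large enough, the four eigenvalues of $\mathcal{A}$ corresponding to the eigenvalue $\mu_n^2$ of $A$, denoted $\lambda_{1,n}^{\pm},\lambda_{2,n}^{\pm}$, satisfy the following asymptotic expansions as $n\to\infty$. Case 1. If $0<\alpha^2\le\frac14$, then $$\lambda_{1,n}^{\pm}=\pm i\mu_n-\frac14+\frac14\sqrt{1-4\alpha^2}+O\left(\frac1{\mu_n}\right),\qquad \lambda_{2,n}^{\pm}=\pm i\mu_n-\frac14-\frac14\sqrt{1-4\alpha^2}+O\left(\frac1{\mu_n}\right).$$ Case 2. If $\alpha^2>\frac14$, then $$\lambda_{1,n}^{\pm}=\pm i\mu_n-\frac14+\frac i4\sqrt{4\alpha^2-1}+O\left(\frac1{\mu_n}\right),\qquad \lambda_{2,n}^{\pm}=\pm i\mu_n-\frac14-\frac i4\sqrt{4\alpha^2-1}+O\left(\frac1{\mu_n}\right).$$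
   Context: $H$ is an infinite-dimensional separable complex Hilbert space; $A$ is a self-adjoint, coercive operator in $H$ with compact resolvent and simple spectrum, so there are an orthonormal basis $(e_n)_{n\ge1}$ of $H$ and an increasing sequence of positive numbers $\mu_n\to\infty$ with $Ae_n=\mu_n^2e_n$. Fractional powers of $A$ are defined by spectral calculus. The parameters satisfy $a>0$, $\gamma\le 0$, $\alpha\in\mathbb{R}\setminus\{0\}$. On $\mathcal{H}=D(A^{1/2})\times H\times D(A^{1/2})\times H$, with norm $\|(u,v,y,z)\|_{\mathcal{H}}^2=a\|A^{1/2}u\|^2+\|A^{1/2}y\|^2+\|v\|^2+\|z\|^2$, the operator $\mathcal{A}$ has domain $D(\mathcal{A})=\{(u,v,y,z)\in\mathcal{H}:\ v,z\in D(A^{1/2}),\ u,y\in D(A)\}$ and acts by $\mathcal{A}(u,v,y,z)=(v,\,-aAu-A^{\gamma}v-\alpha z,\,z,\,-Ay+\alpha v)$. The four eigenvalues of $\mathcal{A}$ corresponding to $\mu_n^2$ are the four roots $\lambda$ (counted with multiplicity) of the characteristic equation $$a\mu_n^4+\lambda\left((a+1)\lambda+\mu_n^{2\gamma}\right)\mu_n^2+\lambda^2\left(\lambda^2+\lambda\mu_n^{2\gamma}+\alpha^2\right)=0 .$$ The statement is understood up to a suitable labelling of these roots as $\lambda_{1,n}^{\pm},\lambda_{2,n}^{\pm}$. *)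

theory Defs
  imports "HOL-Analysis.Analysis"
    "HOL-Library.Landau_Symbols"
    "HOL-Computational_Algebra.Computational_Algebra"
begin

section \<open>Complex Hilbert spaces\<close>

text \<open>The inner product is antilinear in its first and linear in its second argument.\<close>

class complex_inner = real_normed_vector +
  fixes scaleC :: "complex \<Rightarrow> 'a \<Rightarrow> 'a" (infixr \<open>*\<^sub>C\<close> 75)
    and cinner :: "'a \<Rightarrow> 'a \<Rightarrow> complex"
  assumes scaleC_add_right: "c *\<^sub>C (x + y) = c *\<^sub>C x + c *\<^sub>C y"
    and scaleC_add_left: "(c + d) *\<^sub>C x = c *\<^sub>C x + d *\<^sub>C x"
    and scaleC_scaleC: "c *\<^sub>C (d *\<^sub>C x) = (c * d) *\<^sub>C x"
    and scaleC_one: "1 *\<^sub>C x = x"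
    and scaleR_scaleC: "r *\<^sub>R x = complex_of_real r *\<^sub>C x"
    and cinner_commute: "cinner x y = cnj (cinner y x)"
    and cinner_add_right: "cinner x (y + z) = cinner x y + cinner x z"
    and cinner_scaleC_right: "cinner x (c *\<^sub>C y) = c * cinner x y"
    and cinner_self_norm: "cinner x x = complex_of_real ((norm x)\<^sup>2)"

class complex_hilbert = complex_inner + complete_space

global_interpretation cvec: vector_space "scaleC :: complex \<Rightarrow> 'a \<Rightarrow> 'a::complex_inner"
  by unfold_locales (simp_all add: scaleC_add_right scaleC_add_left scaleC_scaleC scaleC_one)

text \<open>Orthonormal bases are indexed by the positive integers.\<close>

definition orthonormal_basis :: "(nat \<Rightarrow> 'h::complex_hilbert) \<Rightarrow> bool" where
  "orthonormal_basis e \<longleftrightarrow>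
     (\<forall>m\<ge>1. \<forall>n\<ge>1. cinner (e m) (e n) = (if m = n then 1 else 0)) \<and>
     closure (cvec.span (e ` {1..})) = UNIV"

section \<open>Unbounded operators\<close>

text \<open>An unbounded operator is a domain \<open>D\<close> together with a function whose values outside
  \<open>D\<close> are irrelevant.\<close>

definition linear_operator :: "'h::complex_hilbert set \<Rightarrow> ('h \<Rightarrow> 'h) \<Rightarrow> bool" where
  "linear_operator D A \<longleftrightarrow> cvec.subspace D \<and>
     (\<forall>x\<in>D. \<forall>y\<in>D. A (x + y) = A x + A y) \<and> (\<forall>c. \<forall>x\<in>D. A (c *\<^sub>C x) = c *\<^sub>C A x)"

text \<open>The pairs \<open>(y, w)\<close> on the left-hand side of the last equivalence form the graph of
  the adjoint.\<close>

definition self_adjoint :: "'h::complex_hilbert set \<Rightarrow> ('h \<Rightarrow> 'h) \<Rightarrow> bool" where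
  "self_adjoint D A \<longleftrightarrow> linear_operator D A \<and> closure D = UNIV \<and>
     (\<forall>y w. (\<forall>x\<in>D. cinner y (A x) = cinner w x) \<longleftrightarrow> y \<in> D \<and> w = A y)"

definition coercive :: "'h::complex_hilbert set \<Rightarrow> ('h \<Rightarrow> 'h) \<Rightarrow> bool" where
  "coercive D A \<longleftrightarrow> (\<exists>c>0. \<forall>x\<in>D. Re (cinner x (A x)) \<ge> c * (norm x)\<^sup>2)"

definition resolvent :: "'h::complex_hilbert set \<Rightarrow> ('h \<Rightarrow> 'h) \<Rightarrow> complex \<Rightarrow> 'h \<Rightarrow> 'h" where
  "resolvent D A z = inv_into D (\<lambda>x. A x - z *\<^sub>C x)"

definition resolvent_set :: "'h::complex_hilbert set \<Rightarrow> ('h \<Rightarrow> 'h) \<Rightarrow> complex set" where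
  "resolvent_set D A =
     {z. bij_betw (\<lambda>x. A x - z *\<^sub>C x) D UNIV \<and> continuous_on UNIV (resolvent D A z)}"

text \<open>By the resolvent identity, compactness at one point of the resolvent set is compactness
  at every point.\<close>

definition compact_resolvent :: "'h::complex_hilbert set \<Rightarrow> ('h \<Rightarrow> 'h) \<Rightarrow> bool" where
  "compact_resolvent D A \<longleftrightarrow>
     (\<exists>z\<in>resolvent_set D A. compact (closure (resolvent D A z ` cball 0 1)))"

text \<open>For a self-adjoint operator geometric and algebraic multiplicities agree, and compactness
  of the resolvent makes the spectrum consist of eigenvalues.\<close>

definition simple_spectrum :: "'h::complex_hilbert set \<Rightarrow> ('h \<Rightarrow> 'h) \<Rightarrow> bool" where
  "simple_spectrum D A \<longleftrightarrow>
     (\<forall>c. (\<exists>x\<in>D. x \<noteq> 0 \<and> A x = c *\<^sub>C x) \<longrightarrow> cvec.dim {x\<in>D. A x = c *\<^sub>C x} = 1)"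

text \<open>Spectral calculus for the operator with \<open>A e\<^sub>n = \<mu>\<^sub>n\<^sup>2 e\<^sub>n\<close>: the power
  \<open>A\<^sup>s\<close> multiplies the \<open>n\<close>-th coordinate by \<open>(\<mu>\<^sub>n\<^sup>2)\<^sup>s\<close>.\<close>

definition frac_domain :: "(nat \<Rightarrow> 'h::complex_hilbert) \<Rightarrow> (nat \<Rightarrow> real) \<Rightarrow> real \<Rightarrow> 'h set" where
  "frac_domain e \<mu> s =
     {x. (\<lambda>n. (\<mu> n powr (2 * s) * cmod (cinner (e n) x))\<^sup>2) summable_on {1..}}"

definition frac_power :: "(nat \<Rightarrow> 'h::complex_hilbert) \<Rightarrow> (nat \<Rightarrow> real) \<Rightarrow> real \<Rightarrow> 'h \<Rightarrow> 'h" where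
  "frac_power e \<mu> s x =
     (\<Sum>\<^sub>\<infinity>n\<in>{1..}. (complex_of_real (\<mu> n powr (2 * s)) * cinner (e n) x) *\<^sub>C e n)"

section \<open>The coupled system\<close>

type_synonym 'h state = "'h \<times> 'h \<times> 'h \<times> 'h"

definition state_space :: "(nat \<Rightarrow> 'h::complex_hilbert) \<Rightarrow> (nat \<Rightarrow> real) \<Rightarrow> 'h state set" where
  "state_space e \<mu> = frac_domain e \<mu> (1/2) \<times> UNIV \<times> frac_domain e \<mu> (1/2) \<times> UNIV"

fun scale_state :: "complex \<Rightarrow> 'h::complex_hilbert state \<Rightarrow> 'h state" where
  "scale_state c (u, v, y, z) = (c *\<^sub>C u, c *\<^sub>C v, c *\<^sub>C y, c *\<^sub>C z)"

definition generator_domain ::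
    "'h::complex_hilbert set \<Rightarrow> (nat \<Rightarrow> 'h) \<Rightarrow> (nat \<Rightarrow> real) \<Rightarrow> 'h state set" where
  "generator_domain D e \<mu> = {(u, v, y, z). (u, v, y, z) \<in> state_space e \<mu> \<and>
     v \<in> frac_domain e \<mu> (1/2) \<and> z \<in> frac_domain e \<mu> (1/2) \<and> u \<in> D \<and> y \<in> D}"

fun generator ::
    "('h::complex_hilbert \<Rightarrow> 'h) \<Rightarrow> (nat \<Rightarrow> 'h) \<Rightarrow> (nat \<Rightarrow> real) \<Rightarrow> real \<Rightarrow> real \<Rightarrow> real \<Rightarrow>
     'h state \<Rightarrow> 'h state" where
  "generator A e \<mu> a \<gamma> \<alpha> (u, v, y, z) =
     (v, - (a *\<^sub>R A u) - frac_power e \<mu> \<gamma> v - \<alpha> *\<^sub>R z, z, - A y + \<alpha> *\<^sub>R v)"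

text \<open>An eigenvalue of the generator corresponds to \<open>\<mu>\<^sub>n\<^sup>2\<close> if it has an eigenvector
  all of whose components are multiples of \<open>e\<^sub>n\<close>.\<close>

definition mode_space :: "'h::complex_hilbert \<Rightarrow> 'h state set" where
  "mode_space x = {(p *\<^sub>C x, q *\<^sub>C x, r *\<^sub>C x, s *\<^sub>C x) | p q r s. True}"

definition mode_eigenvalues ::
    "'h::complex_hilbert set \<Rightarrow> ('h \<Rightarrow> 'h) \<Rightarrow> (nat \<Rightarrow> 'h) \<Rightarrow> (nat \<Rightarrow> real) \<Rightarrow>
     real \<Rightarrow> real \<Rightarrow> real \<Rightarrow> nat \<Rightarrow> complex set" where
  "mode_eigenvalues D A e \<mu> a \<gamma> \<alpha> n =
     {c. \<exists>U \<in> generator_domain D e \<mu> \<inter> mode_space (e n).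
           U \<noteq> 0 \<and> generator A e \<mu> a \<gamma> \<alpha> U = scale_state c U}"

text \<open>The characteristic polynomial
  \<open>a m\<^sup>4 + X ((a+1) X + m\<^bsup>2\<gamma>\<^esup>) m\<^sup>2 + X\<^sup>2 (X\<^sup>2 + m\<^bsup>2\<gamma>\<^esup> X + \<alpha>\<^sup>2)\<close>;
  coefficient lists start with the constant term.\<close>

definition char_polynomial :: "real \<Rightarrow> real \<Rightarrow> real \<Rightarrow> real \<Rightarrow> complex poly" where
  "char_polynomial a \<gamma> \<alpha> m = map_poly complex_of_real
     ([:a * m ^ 4:]
      + [:0, 1:] * [:m powr (2 * \<gamma>), a + 1:] * [:m ^ 2:]
      + [:0, 1:] ^ 2 * [:\<alpha>\<^sup>2, m powr (2 * \<gamma>), 1:])"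

text \<open>Four sequences label the eigenvalues if for each \<open>n \<ge> 1\<close> they list the roots of the
  characteristic polynomial with multiplicity, and these are precisely the eigenvalues of the
  generator corresponding to \<open>\<mu>\<^sub>n\<^sup>2\<close>.\<close>

definition labels_eigenvalues ::
    "'h::complex_hilbert set \<Rightarrow> ('h \<Rightarrow> 'h) \<Rightarrow> (nat \<Rightarrow> 'h) \<Rightarrow> (nat \<Rightarrow> real) \<Rightarrow>
     real \<Rightarrow> real \<Rightarrow> real \<Rightarrow>
     (nat \<Rightarrow> complex) \<Rightarrow> (nat \<Rightarrow> complex) \<Rightarrow> (nat \<Rightarrow> complex) \<Rightarrow> (nat \<Rightarrow> complex) \<Rightarrow> bool" where
  "labels_eigenvalues D A e \<mu> a \<gamma> \<alpha> l1p l1m l2p l2m \<longleftrightarrow>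
     (\<forall>n\<ge>1. {#l1p n, l1m n, l2p n, l2m n#} = proots (char_polynomial a \<gamma> \<alpha> (\<mu> n)) \<and>
            {l1p n, l1m n, l2p n, l2m n} = mode_eigenvalues D A e \<mu> a \<gamma> \<alpha> n)"

end

theory Submission
  imports Defs
begin

text \<open>With \<open>a = 1\<close> and \<open>\<gamma> = 0\<close> the characteristic polynomial is a binary quadratic form in
  \<open>X\<^sup>2 + \<mu>\<^sub>n\<^sup>2\<close> and \<open>X\<close>, namely
  \<open>(X\<^sup>2 + \<mu>\<^sub>n\<^sup>2)\<^sup>2 + X (X\<^sup>2 + \<mu>\<^sub>n\<^sup>2) + \<alpha>\<^sup>2 X\<^sup>2\<close>.  It therefore splits as
  \<open>(X\<^sup>2 - \<kappa>\<^sub>1 X + \<mu>\<^sub>n\<^sup>2) (X\<^sup>2 - \<kappa>\<^sub>2 X + \<mu>\<^sub>n\<^sup>2)\<close>, where \<open>\<kappa>\<^sub>1\<close> and \<open>\<kappa>\<^sub>2\<close> are the roots of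
  \<open>t\<^sup>2 + t + \<alpha>\<^sup>2\<close>: real in the first case of the theorem, complex conjugate in the second.
  As \<open>\<kappa>\<^sub>1\<close> and \<open>\<kappa>\<^sub>2\<close> do not depend on \<open>n\<close>, expanding the roots is elementary: their closed form is
  \<open>\<kappa>/2 \<plusminus> i \<mu>\<^sub>n \<surd>(1 - (\<kappa> / (2\<mu>\<^sub>n))\<^sup>2)\<close>.  They differ from \<open>\<plusminus>i \<mu>\<^sub>n + \<kappa>/2\<close> by at most
  \<open>|\<kappa>|\<^sup>2 / (4\<mu>\<^sub>n)\<close> (\<open>norm_vieta_root_diff_le\<close>), and the expansions follow; both cases are
  instances of one lemma with a complex parameter (\<open>labelled_eigenvalue_expansion\<close>).

  That the roots are the eigenvalues of the generator on the \<open>n\<close>-th mode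
  (\<open>mode_eigenvalues_eq_roots\<close>) is linear algebra valid for all \<open>a\<close>, \<open>\<gamma>\<close> and nonzero \<open>\<alpha>\<close>: the
  generator leaves the mode space invariant, and eliminating the two velocities leaves a
  \<open>2 \<times> 2\<close> system whose determinant is the characteristic polynomial.\<close>

section \<open>The generator on a single mode\<close>

lemma orthonormal_basis_nonzero:
  assumes "orthonormal_basis e" "n \<ge> 1"
  shows "e n \<noteq> 0"
proof
  assume "e n = 0"
  moreover have "cinner (e n) (e n) = 1"
    using assms by (simp add: orthonormal_basis_def)
  ultimately show False
    by (simp add: cinner_self_norm)
qed

lemma cinner_basis_mode:
  assumes "orthonormal_basis e" "n \<ge> 1" "k \<ge> 1"
  shows "cinner (e k) (q *\<^sub>C e n) = (if k = n then q else 0)"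
  using assms by (simp add: orthonormal_basis_def cinner_scaleC_right)

lemma mode_in_frac_domain:
  assumes "orthonormal_basis e" "n \<ge> 1"
  shows "q *\<^sub>C e n \<in> frac_domain e \<mu> s"
proof -
  have "(\<lambda>k. (\<mu> k powr (2 * s) * cmod (cinner (e k) (q *\<^sub>C e n)))\<^sup>2) summable_on {1..}
    \<longleftrightarrow> (\<lambda>k. (\<mu> k powr (2 * s) * cmod q)\<^sup>2) summable_on {n}"
    by (rule summable_on_cong_neutral) (use assms in \<open>auto simp: cinner_basis_mode\<close>)
  then show ?thesis
    by (simp add: frac_domain_def)
qed

lemma frac_power_mode:
  assumes "orthonormal_basis e" "n \<ge> 1"
  shows "frac_power e \<mu> s (q *\<^sub>C e n) = (complex_of_real (\<mu> n powr (2 * s)) * q) *\<^sub>C e n"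
proof -
  have "frac_power e \<mu> s (q *\<^sub>C e n)
      = (\<Sum>\<^sub>\<infinity>k\<in>{n}. (complex_of_real (\<mu> k powr (2 * s)) * q) *\<^sub>C e k)"
    unfolding frac_power_def
    by (rule infsum_cong_neutral) (use assms in \<open>auto simp: cinner_basis_mode\<close>)
  then show ?thesis
    by simp
qed

lemma generator_mode:
  assumes "linear_operator D A" "orthonormal_basis e" "n \<ge> 1"
    and "e n \<in> D" "A (e n) = (\<mu> n)\<^sup>2 *\<^sub>R e n"
  shows "generator A e \<mu> a \<gamma> \<alpha> (p *\<^sub>C e n, q *\<^sub>C e n, r *\<^sub>C e n, s *\<^sub>C e n)
    = (q *\<^sub>C e n,
       - (a * (\<mu> n)\<^sup>2 * p + of_real (\<mu> n powr (2 * \<gamma>)) * q + \<alpha> * s) *\<^sub>C e n,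
       s *\<^sub>C e n,
       (\<alpha> * q - (\<mu> n)\<^sup>2 * r) *\<^sub>C e n)"
proof -
  have "A (c *\<^sub>C e n) = (c * (\<mu> n)\<^sup>2) *\<^sub>C e n" for c
    using assms by (simp add: linear_operator_def scaleR_scaleC scaleC_scaleC)
  then show ?thesis
    using assms(2,3)
    by (simp add: frac_power_mode scaleR_scaleC scaleC_scaleC algebra_simps
        cvec.scale_left_diff_distrib scaleC_add_left)
qed

lemma mode_in_generator_domain:
  assumes "linear_operator D A" "orthonormal_basis e" "n \<ge> 1" "e n \<in> D"
  shows "(p *\<^sub>C e n, q *\<^sub>C e n, r *\<^sub>C e n, s *\<^sub>C e n) \<in> generator_domain D e \<mu>"
proof -
  have "c *\<^sub>C e n \<in> D" for c
    using assms by (auto simp: linear_operator_def intro: cvec.subspace_scale)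
  then show ?thesis
    using assms by (simp add: generator_domain_def state_space_def mode_in_frac_domain)
qed

lemma poly_char_polynomial:
  "poly (char_polynomial a \<gamma> \<alpha> m) x
    = (a * m\<^sup>2 + x\<^sup>2 + of_real (m powr (2 * \<gamma>)) * x) * (x\<^sup>2 + m\<^sup>2) + (\<alpha> * x)\<^sup>2"
  unfolding char_polynomial_def
  by (simp add: map_poly_pCons algebra_simps power2_eq_square power4_eq_xxxx)

text \<open>The first and third components of the eigenvalue equation give \<open>q = c p\<close> and
  \<open>s = c r\<close>.  The other two become a homogeneous system for \<open>(p, r)\<close> with determinant the
  characteristic polynomial at \<open>c\<close>.  When the determinant vanishes, \<open>(c\<^sup>2 + m\<^sup>2, \<alpha> c)\<close> is a
  solution.  It is not zero: \<open>\<alpha> c = 0\<close> forces \<open>c = 0\<close>, and then the first entry is \<open>m\<^sup>2 \<noteq> 0\<close>.\<close>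

lemma mode_system_solvable_iff:
  fixes m a g \<alpha> c :: complex
  assumes "m \<noteq> 0" "\<alpha> \<noteq> 0"
  shows "(\<exists>p q r s. (p, q, r, s) \<noteq> (0, 0, 0, 0) \<and> q = c * p \<and>
           - (a * m\<^sup>2 * p + g * q + \<alpha> * s) = c * q \<and> s = c * r \<and>
           \<alpha> * q - m\<^sup>2 * r = c * s)
    \<longleftrightarrow> (a * m\<^sup>2 + c\<^sup>2 + g * c) * (c\<^sup>2 + m\<^sup>2) + (\<alpha> * c)\<^sup>2 = 0"
    (is "?L \<longleftrightarrow> ?det = 0")
proof
  assume ?L
  then obtain p r where nz: "p \<noteq> 0 \<or> r \<noteq> 0"
    and damped: "- (a * m\<^sup>2 * p + g * (c * p) + \<alpha> * (c * r)) = c * (c * p)"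
    and undamped: "\<alpha> * (c * p) - m\<^sup>2 * r = c * (c * r)"
    by auto
  have "?det * p = 0" "?det * r = 0"
    using damped undamped by algebra+
  with nz show "?det = 0"
    by auto
next
  assume det: "?det = 0"
  \<comment> \<open>A solution of the undamped equation for every \<open>c\<close>; in the damped one it produces the
    determinant.\<close>
  define p r where "p = c\<^sup>2 + m\<^sup>2" and "r = \<alpha> * c"
  have "(p, c * p, r, c * r) \<noteq> (0, 0, 0, 0)"
    using assms by (auto simp: p_def r_def)
  moreover have "- (a * m\<^sup>2 * p + g * (c * p) + \<alpha> * (c * r)) = c * (c * p)"
    using det unfolding p_def r_def by algebra
  moreover have "\<alpha> * (c * p) - m\<^sup>2 * r = c * (c * r)"
    unfolding p_def r_def by algebra
  ultimately show ?L
    by blast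
qed

lemma mode_eigenvalues_eq_roots:
  assumes "linear_operator D A" "orthonormal_basis e" "n \<ge> 1"
    and "e n \<in> D" "A (e n) = (\<mu> n)\<^sup>2 *\<^sub>R e n" and "\<mu> n \<noteq> 0" "\<alpha> \<noteq> 0"
  shows "mode_eigenvalues D A e \<mu> a \<gamma> \<alpha> n = {c. poly (char_polynomial a \<gamma> \<alpha> (\<mu> n)) c = 0}"
proof (rule set_eqI)
  fix c
  have nz: "e n \<noteq> 0"
    using assms by (simp add: orthonormal_basis_nonzero)
  have eq_iff: "x *\<^sub>C e n = y *\<^sub>C e n \<longleftrightarrow> x = y" "x *\<^sub>C e n = 0 \<longleftrightarrow> x = 0" for x y
    using nz by auto
  have "c \<in> mode_eigenvalues D A e \<mu> a \<gamma> \<alpha> n \<longleftrightarrow>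
    (\<exists>p q r s. (p *\<^sub>C e n, q *\<^sub>C e n, r *\<^sub>C e n, s *\<^sub>C e n) \<noteq> 0 \<and>
       generator A e \<mu> a \<gamma> \<alpha> (p *\<^sub>C e n, q *\<^sub>C e n, r *\<^sub>C e n, s *\<^sub>C e n)
         = scale_state c (p *\<^sub>C e n, q *\<^sub>C e n, r *\<^sub>C e n, s *\<^sub>C e n))"
    using mode_in_generator_domain[OF assms(1-4)]
    unfolding mode_eigenvalues_def mode_space_def by blast
  also have "\<dots> \<longleftrightarrow> (\<exists>(p::complex) (q::complex) (r::complex) (s::complex). (p, q, r, s) \<noteq> (0, 0, 0, 0) \<and> q = c * p \<and>
      - (a * (\<mu> n)\<^sup>2 * p + of_real (\<mu> n powr (2 * \<gamma>)) * q + \<alpha> * s) = c * q \<and> s = c * r \<and>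
      \<alpha> * q - (\<mu> n)\<^sup>2 * r = c * s)"
    unfolding generator_mode[where \<mu> = \<mu>, OF assms(1-5)] scale_state.simps scaleC_scaleC zero_prod_def
      prod.inject eq_iff of_real_mult of_real_power ..
  also have "\<dots> \<longleftrightarrow> poly (char_polynomial a \<gamma> \<alpha> (\<mu> n)) c = 0"
    unfolding poly_char_polynomial
    using mode_system_solvable_iff[of "of_real (\<mu> n)" "of_real \<alpha>" c "of_real a"
        "of_real (\<mu> n powr (2 * \<gamma>))"] assms by simp
  finally show "c \<in> mode_eigenvalues D A e \<mu> a \<gamma> \<alpha> n \<longleftrightarrow>
      c \<in> {c. poly (char_polynomial a \<gamma> \<alpha> (\<mu> n)) c = 0}"
    by simp
qed

section \<open>The quadratic factors and their roots\<close>

text \<open>For \<open>\<sigma> = \<plusminus>1\<close> and \<open>m \<noteq> 0\<close> these are the two roots of \<open>X\<^sup>2 - \<kappa> X + m\<^sup>2\<close>.  The factor \<open>m\<close> is taken out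
  of the square root so that the argument of \<open>csqrt\<close> tends to \<open>1\<close> as \<open>m\<close> grows; thus \<open>\<sigma>\<close> selects
  the root near \<open>\<sigma> i m\<close>.\<close>

definition vieta_root :: "complex \<Rightarrow> complex \<Rightarrow> real \<Rightarrow> complex" where
  "vieta_root \<kappa> \<sigma> m = \<kappa> / 2 + \<sigma> * \<i> * m * csqrt (1 - (\<kappa> / (2 * m))\<^sup>2)"

lemma vieta_root_factorization:
  assumes "m \<noteq> 0"
  shows "[:- vieta_root \<kappa> 1 m, 1:] * [:- vieta_root \<kappa> (- 1) m, 1:] = [:(of_real m)\<^sup>2, - \<kappa>, 1:]"
proof -
  define w where "w = csqrt (1 - (\<kappa> / (2 * m))\<^sup>2)"
  have "w\<^sup>2 = 1 - (\<kappa> / (2 * m))\<^sup>2"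
    by (simp add: w_def)
  then have "m\<^sup>2 * w\<^sup>2 = m\<^sup>2 - \<kappa>\<^sup>2 / 4"
    using assms by (simp add: field_simps power2_eq_square)
  then have "(\<kappa> / 2)\<^sup>2 - (\<i> * m * w)\<^sup>2 = m\<^sup>2"
    by (simp add: power_mult_distrib field_simps)
  moreover have roots: "vieta_root \<kappa> 1 m = \<kappa> / 2 + \<i> * m * w" "vieta_root \<kappa> (- 1) m = \<kappa> / 2 - \<i> * m * w"
    by (simp_all add: vieta_root_def w_def)
  ultimately have "vieta_root \<kappa> 1 m * vieta_root \<kappa> (- 1) m = m\<^sup>2"
    "vieta_root \<kappa> 1 m + vieta_root \<kappa> (- 1) m = \<kappa>"
    unfolding roots by (simp_all add: algebra_simps power2_eq_square)
  then show ?thesis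
    by (simp add: algebra_simps)
qed

text \<open>Rationalising, \<open>\<surd>(1 - z) - 1 = - z / (\<surd>(1 - z) + 1)\<close>, and the denominator has real part
  at least \<open>1\<close> because the principal branch lies in the closed right half plane.\<close>

lemma norm_csqrt_one_minus_le: "norm (csqrt (1 - z) - 1) \<le> norm z"
proof -
  define w where "w = csqrt (1 - z)"
  have "(w - 1) * (w + 1) = - z"
    using power2_csqrt[of "1 - z"] by (simp add: w_def algebra_simps power2_eq_square)
  then have prod: "norm (w - 1) * norm (w + 1) = norm z"
    by (metis norm_minus_cancel norm_mult)
  have "1 \<le> Re (w + 1)"
    using Re_csqrt[of "1 - z"] by (simp add: w_def)
  also have "\<dots> \<le> norm (w + 1)"
    by (rule complex_Re_le_cmod)
  finally have "norm (w - 1) * 1 \<le> norm (w - 1) * norm (w + 1)"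
    by (intro mult_left_mono) auto
  with prod show ?thesis
    by (simp add: w_def)
qed

lemma norm_vieta_root_diff_le:
  assumes "m > 0" "norm \<sigma> = 1"
  shows "norm (vieta_root \<kappa> \<sigma> m - (\<sigma> * \<i> * m + \<kappa> / 2)) \<le> (norm \<kappa>)\<^sup>2 / 4 * (1 / m)"
proof -
  have "vieta_root \<kappa> \<sigma> m - (\<sigma> * \<i> * m + \<kappa> / 2)
      = \<sigma> * \<i> * m * (csqrt (1 - (\<kappa> / (2 * m))\<^sup>2) - 1)"
    by (simp add: vieta_root_def algebra_simps)
  then have "norm (vieta_root \<kappa> \<sigma> m - (\<sigma> * \<i> * m + \<kappa> / 2))
      = m * norm (csqrt (1 - (\<kappa> / (2 * m))\<^sup>2) - 1)"
    using assms by (simp add: norm_mult)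
  also have "\<dots> \<le> m * norm ((\<kappa> / (2 * m))\<^sup>2)"
    using assms by (intro mult_left_mono norm_csqrt_one_minus_le) auto
  also have "\<dots> = (norm \<kappa>)\<^sup>2 / 4 * (1 / m)"
    using assms by (simp add: norm_power norm_divide norm_mult field_simps power2_eq_square)
  finally show ?thesis .
qed

lemma vieta_root_expansion:
  assumes pos: "\<And>n. n \<ge> 1 \<Longrightarrow> \<mu> n > 0" and "norm \<sigma> = 1"
  shows "(\<lambda>n. vieta_root \<kappa> \<sigma> (\<mu> n) - (\<sigma> * \<i> * of_real (\<mu> n) + \<kappa> / 2))
    \<in> O(\<lambda>n::nat. of_real (1 / \<mu> n))"
proof (rule bigoI)
  show "\<forall>\<^sub>F n in sequentially.
      norm (vieta_root \<kappa> \<sigma> (\<mu> n) - (\<sigma> * \<i> * of_real (\<mu> n) + \<kappa> / 2))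
        \<le> (norm \<kappa>)\<^sup>2 / 4 * norm (complex_of_real (1 / \<mu> n))"
    using eventually_ge_at_top[of 1]
  proof eventually_elim
    case (elim n)
    then show ?case
      using norm_vieta_root_diff_le[OF pos[OF elim] assms(2)] pos[OF elim]
      by (simp add: norm_divide)
  qed
qed

text \<open>The hypotheses say that \<open>s\<^sup>2 + s t + \<alpha>\<^sup>2 t\<^sup>2 = (s - \<kappa>\<^sub>1 t) (s - \<kappa>\<^sub>2 t)\<close>; the identity is
  the case \<open>s = X\<^sup>2 + m\<^sup>2\<close>, \<open>t = X\<close>.  The assumption \<open>m > 0\<close> gives \<open>m powr 0 = 1\<close>.\<close>

lemma char_polynomial_factorization:
  assumes "\<kappa>1 + \<kappa>2 = - 1" "\<kappa>1 * \<kappa>2 = of_real (\<alpha>\<^sup>2)" "m > 0"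
  shows "char_polynomial 1 0 \<alpha> m
    = [:(of_real m)\<^sup>2, - \<kappa>1, 1:] * [:(of_real m)\<^sup>2, - \<kappa>2, 1:]"
proof (rule poly_ext)
  fix x
  have "\<kappa>2 = - 1 - \<kappa>1"
    using assms(1) by (simp add: algebra_simps)
  with assms(2) have "complex_of_real \<alpha> ^ 2 = \<kappa>1 * (- 1 - \<kappa>1)"
    by simp
  then show "poly (char_polynomial 1 0 \<alpha> m) x
      = poly ([:(of_real m)\<^sup>2, - \<kappa>1, 1:] * [:(of_real m)\<^sup>2, - \<kappa>2, 1:]) x"
    using assms(3) unfolding poly_char_polynomial \<open>\<kappa>2 = - 1 - \<kappa>1\<close>
    by simp algebra
qed

section \<open>Asymptotic expansion of the eigenvalues\<close>

text \<open>The roots of \<open>t\<^sup>2 + t + \<alpha>\<^sup>2\<close> are \<open>- 1/2 \<plusminus> 2\<delta>\<close> with \<open>16 \<delta>\<^sup>2 = 1 - 4 \<alpha>\<^sup>2\<close>.  A complex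
  parameter \<open>\<delta>\<close> covers both signs of \<open>1 - 4 \<alpha>\<^sup>2\<close>, including the double root \<open>\<delta> = 0\<close>,
  because no expansion in \<open>\<delta>\<close> is made.\<close>

lemma labelled_eigenvalue_expansion:
  assumes "linear_operator D A" "orthonormal_basis e"
    and eigen: "\<And>n. n \<ge> 1 \<Longrightarrow> e n \<in> D \<and> A (e n) = (\<mu> n)\<^sup>2 *\<^sub>R e n"
    and pos: "\<And>n. n \<ge> 1 \<Longrightarrow> \<mu> n > 0"
    and "\<alpha> \<noteq> 0" and \<delta>: "(4 * \<delta>)\<^sup>2 = complex_of_real (1 - 4 * \<alpha>\<^sup>2)"
  shows "\<exists>l1p l1m l2p l2m. labels_eigenvalues D A e \<mu> 1 0 \<alpha> l1p l1m l2p l2m \<and>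
        (\<lambda>n. l1p n - (\<i> * of_real (\<mu> n) - 1/4 + \<delta>)) \<in> O(\<lambda>n. of_real (1 / \<mu> n)) \<and>
        (\<lambda>n. l1m n - (- \<i> * of_real (\<mu> n) - 1/4 + \<delta>)) \<in> O(\<lambda>n. of_real (1 / \<mu> n)) \<and>
        (\<lambda>n. l2p n - (\<i> * of_real (\<mu> n) - 1/4 - \<delta>)) \<in> O(\<lambda>n. of_real (1 / \<mu> n)) \<and>
        (\<lambda>n. l2m n - (- \<i> * of_real (\<mu> n) - 1/4 - \<delta>)) \<in> O(\<lambda>n. of_real (1 / \<mu> n))"
proof -
  define \<kappa>1 \<kappa>2 where "\<kappa>1 = 2 * \<delta> - 1/2" and "\<kappa>2 = - 2 * \<delta> - 1/2"
  have \<kappa>: "\<kappa>1 + \<kappa>2 = - 1" "\<kappa>1 * \<kappa>2 = of_real (\<alpha>\<^sup>2)"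
    using \<delta> by (simp_all add: \<kappa>1_def \<kappa>2_def algebra_simps power2_eq_square)
  define l where "l \<kappa> \<sigma> n = vieta_root \<kappa> \<sigma> (\<mu> n)" for \<kappa> \<sigma> and n :: nat
  have "labels_eigenvalues D A e \<mu> 1 0 \<alpha> (l \<kappa>1 1) (l \<kappa>1 (- 1)) (l \<kappa>2 1) (l \<kappa>2 (- 1))"
    unfolding labels_eigenvalues_def
  proof (intro allI impI conjI)
    fix n :: nat
    assume n: "n \<ge> 1"
    let ?p = "char_polynomial 1 0 \<alpha> (\<mu> n)"
    have p: "?p = [:- l \<kappa>1 1 n, 1:] * [:- l \<kappa>1 (- 1) n, 1:]
        * ([:- l \<kappa>2 1 n, 1:] * [:- l \<kappa>2 (- 1) n, 1:])"
      using pos[OF n] \<kappa> by (simp only: l_def vieta_root_factorization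
          char_polynomial_factorization less_imp_neq[symmetric] not_False_eq_True)
    show proots: "{#l \<kappa>1 1 n, l \<kappa>1 (- 1) n, l \<kappa>2 1 n, l \<kappa>2 (- 1) n#} = proots ?p"
      unfolding p
      by (simp add: proots_mult add_mset_commute del: mult_pCons_left mult_pCons_right)
    have "?p \<noteq> 0"
      unfolding p by (simp only: mult_eq_0_iff pCons_eq_0_iff) simp
    then have "set_mset (proots ?p) = {c. poly ?p c = 0}"
      by simp
    then show "{l \<kappa>1 1 n, l \<kappa>1 (- 1) n, l \<kappa>2 1 n, l \<kappa>2 (- 1) n}
        = mode_eigenvalues D A e \<mu> 1 0 \<alpha> n"
      using mode_eigenvalues_eq_roots[OF assms(1,2) n, of \<mu> \<alpha> 1 0] eigen[OF n] pos[OF n]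
        \<open>\<alpha> \<noteq> 0\<close> by (simp flip: proots)
  qed
  moreover have "(\<lambda>n. l \<kappa> 1 n - (\<i> * of_real (\<mu> n) - 1/4 + d)) \<in> O(\<lambda>n. of_real (1 / \<mu> n))"
    "(\<lambda>n. l \<kappa> (- 1) n - (- \<i> * of_real (\<mu> n) - 1/4 + d)) \<in> O(\<lambda>n. of_real (1 / \<mu> n))"
    if "\<kappa> = 2 * d - 1/2" for \<kappa> d
  proof -
    have "\<kappa> / 2 = - 1/4 + d"
      using that by simp
    from vieta_root_expansion[of \<mu> 1 \<kappa>, OF pos, unfolded this]
      vieta_root_expansion[of \<mu> "- 1" \<kappa>, OF pos, unfolded this]
    show "(\<lambda>n. l \<kappa> 1 n - (\<i> * of_real (\<mu> n) - 1/4 + d)) \<in> O(\<lambda>n. of_real (1 / \<mu> n))"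
      "(\<lambda>n. l \<kappa> (- 1) n - (- \<i> * of_real (\<mu> n) - 1/4 + d)) \<in> O(\<lambda>n. of_real (1 / \<mu> n))"
      by (simp_all add: l_def algebra_simps)
  qed
  from this[of \<kappa>1 \<delta>] this[of \<kappa>2 "- \<delta>"]
  have "(\<lambda>n. l \<kappa>1 1 n - (\<i> * of_real (\<mu> n) - 1/4 + \<delta>)) \<in> O(\<lambda>n. of_real (1 / \<mu> n))"
    "(\<lambda>n. l \<kappa>1 (- 1) n - (- \<i> * of_real (\<mu> n) - 1/4 + \<delta>)) \<in> O(\<lambda>n. of_real (1 / \<mu> n))"
    "(\<lambda>n. l \<kappa>2 1 n - (\<i> * of_real (\<mu> n) - 1/4 - \<delta>)) \<in> O(\<lambda>n. of_real (1 / \<mu> n))"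
    "(\<lambda>n. l \<kappa>2 (- 1) n - (- \<i> * of_real (\<mu> n) - 1/4 - \<delta>)) \<in> O(\<lambda>n. of_real (1 / \<mu> n))"
    by (simp_all add: \<kappa>1_def \<kappa>2_def)
  ultimately show ?thesis
    by blast
qed

theorem lemma3p2:
  fixes D :: "'h::complex_hilbert set" and A :: "'h \<Rightarrow> 'h"
    and e :: "nat \<Rightarrow> 'h" and \<mu> :: "nat \<Rightarrow> real"
    and a \<gamma> \<alpha> :: real
  assumes infinite_dim: "\<nexists>B :: 'h set. finite B \<and> cvec.span B = UNIV"
    and separable: "\<exists>S :: 'h set. countable S \<and> closure S = UNIV"
    and "self_adjoint D A" and "coercive D A"
    and "compact_resolvent D A" and "simple_spectrum D A"
    and "orthonormal_basis e"
    and eigen: "\<And>n. n \<ge> 1 \<Longrightarrow> e n \<in> D \<and> A (e n) = (\<mu> n)\<^sup>2 *\<^sub>R e n"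
    and mu_pos: "\<And>n. n \<ge> 1 \<Longrightarrow> \<mu> n > 0"
    and mu_incr: "strict_mono_on {1..} \<mu>"
    and mu_lim: "filterlim \<mu> at_top sequentially"
    and "\<alpha> \<noteq> 0" and "a = 1" and "\<gamma> = 0"
  shows "(0 < \<alpha>\<^sup>2 \<and> \<alpha>\<^sup>2 \<le> 1/4 \<longrightarrow>
      (\<exists>l1p l1m l2p l2m. labels_eigenvalues D A e \<mu> a \<gamma> \<alpha> l1p l1m l2p l2m \<and>
        (\<lambda>n. l1p n - (\<i> * of_real (\<mu> n) - 1/4 + 1/4 * of_real (sqrt (1 - 4 * \<alpha>\<^sup>2))))
          \<in> O(\<lambda>n. of_real (1 / \<mu> n)) \<and>
        (\<lambda>n. l1m n - (- \<i> * of_real (\<mu> n) - 1/4 + 1/4 * of_real (sqrt (1 - 4 * \<alpha>\<^sup>2))))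
          \<in> O(\<lambda>n. of_real (1 / \<mu> n)) \<and>
        (\<lambda>n. l2p n - (\<i> * of_real (\<mu> n) - 1/4 - 1/4 * of_real (sqrt (1 - 4 * \<alpha>\<^sup>2))))
          \<in> O(\<lambda>n. of_real (1 / \<mu> n)) \<and>
        (\<lambda>n. l2m n - (- \<i> * of_real (\<mu> n) - 1/4 - 1/4 * of_real (sqrt (1 - 4 * \<alpha>\<^sup>2))))
          \<in> O(\<lambda>n. of_real (1 / \<mu> n)))) \<and>
    (\<alpha>\<^sup>2 > 1/4 \<longrightarrow>
      (\<exists>l1p l1m l2p l2m. labels_eigenvalues D A e \<mu> a \<gamma> \<alpha> l1p l1m l2p l2m \<and>
        (\<lambda>n. l1p n - (\<i> * of_real (\<mu> n) - 1/4 + \<i>/4 * of_real (sqrt (4 * \<alpha>\<^sup>2 - 1))))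
          \<in> O(\<lambda>n. of_real (1 / \<mu> n)) \<and>
        (\<lambda>n. l1m n - (- \<i> * of_real (\<mu> n) - 1/4 + \<i>/4 * of_real (sqrt (4 * \<alpha>\<^sup>2 - 1))))
          \<in> O(\<lambda>n. of_real (1 / \<mu> n)) \<and>
        (\<lambda>n. l2p n - (\<i> * of_real (\<mu> n) - 1/4 - \<i>/4 * of_real (sqrt (4 * \<alpha>\<^sup>2 - 1))))
          \<in> O(\<lambda>n. of_real (1 / \<mu> n)) \<and>
        (\<lambda>n. l2m n - (- \<i> * of_real (\<mu> n) - 1/4 - \<i>/4 * of_real (sqrt (4 * \<alpha>\<^sup>2 - 1))))
          \<in> O(\<lambda>n. of_real (1 / \<mu> n))))"
proof -
  have lin: "linear_operator D A"
    using \<open>self_adjoint D A\<close> by (simp add: self_adjoint_def)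
  note expansion = labelled_eigenvalue_expansion
    [OF lin \<open>orthonormal_basis e\<close> eigen mu_pos \<open>\<alpha> \<noteq> 0\<close>]
  show ?thesis
    unfolding \<open>a = 1\<close> \<open>\<gamma> = 0\<close>
  proof (rule conjI; rule impI)
    assume "0 < \<alpha>\<^sup>2 \<and> \<alpha>\<^sup>2 \<le> 1/4"
    then have "(complex_of_real (sqrt (1 - 4 * \<alpha>\<^sup>2)))\<^sup>2 = of_real (1 - 4 * \<alpha>\<^sup>2)"
      by (simp flip: of_real_power)
    then have "(4 * (1/4 * complex_of_real (sqrt (1 - 4 * \<alpha>\<^sup>2))))\<^sup>2 = of_real (1 - 4 * \<alpha>\<^sup>2)"
      by simp
    from expansion[OF _ _ this] show
      "\<exists>l1p l1m l2p l2m. labels_eigenvalues D A e \<mu> 1 0 \<alpha> l1p l1m l2p l2m \<and>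
        (\<lambda>n. l1p n - (\<i> * of_real (\<mu> n) - 1/4 + 1/4 * of_real (sqrt (1 - 4 * \<alpha>\<^sup>2)))) \<in> O(\<lambda>n. of_real (1 / \<mu> n)) \<and>
        (\<lambda>n. l1m n - (- \<i> * of_real (\<mu> n) - 1/4 + 1/4 * of_real (sqrt (1 - 4 * \<alpha>\<^sup>2)))) \<in> O(\<lambda>n. of_real (1 / \<mu> n)) \<and>
        (\<lambda>n. l2p n - (\<i> * of_real (\<mu> n) - 1/4 - 1/4 * of_real (sqrt (1 - 4 * \<alpha>\<^sup>2)))) \<in> O(\<lambda>n. of_real (1 / \<mu> n)) \<and>
        (\<lambda>n. l2m n - (- \<i> * of_real (\<mu> n) - 1/4 - 1/4 * of_real (sqrt (1 - 4 * \<alpha>\<^sup>2)))) \<in> O(\<lambda>n. of_real (1 / \<mu> n))"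
      by assumption
  next
    assume "\<alpha>\<^sup>2 > 1/4"
    then have "(complex_of_real (sqrt (4 * \<alpha>\<^sup>2 - 1)))\<^sup>2 = of_real (4 * \<alpha>\<^sup>2 - 1)"
      by (simp flip: of_real_power)
    then have "(4 * (\<i>/4 * complex_of_real (sqrt (4 * \<alpha>\<^sup>2 - 1))))\<^sup>2 = of_real (1 - 4 * \<alpha>\<^sup>2)"
      by (simp add: power_mult_distrib)
    from expansion[OF _ _ this] show
      "\<exists>l1p l1m l2p l2m. labels_eigenvalues D A e \<mu> 1 0 \<alpha> l1p l1m l2p l2m \<and>
        (\<lambda>n. l1p n - (\<i> * of_real (\<mu> n) - 1/4 + \<i>/4 * of_real (sqrt (4 * \<alpha>\<^sup>2 - 1)))) \<in> O(\<lambda>n. of_real (1 / \<mu> n)) \<and>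
        (\<lambda>n. l1m n - (- \<i> * of_real (\<mu> n) - 1/4 + \<i>/4 * of_real (sqrt (4 * \<alpha>\<^sup>2 - 1)))) \<in> O(\<lambda>n. of_real (1 / \<mu> n)) \<and>
        (\<lambda>n. l2p n - (\<i> * of_real (\<mu> n) - 1/4 - \<i>/4 * of_real (sqrt (4 * \<alpha>\<^sup>2 - 1)))) \<in> O(\<lambda>n. of_real (1 / \<mu> n)) \<and>
        (\<lambda>n. l2m n - (- \<i> * of_real (\<mu> n) - 1/4 - \<i>/4 * of_real (sqrt (4 * \<alpha>\<^sup>2 - 1)))) \<in> O(\<lambda>n. of_real (1 / \<mu> n))"
      by assumption
  qed
qed

end
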